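(* Let $s\ge 1$ be an integer and let $f,g$ be arithmetical functions having absolutely convergent Cohen-Ramanujan expansions $$f(n)=\sum_{r\ge1}\widehat f(r)\,c_r^{(s)}(n),\qquad g(n)=\sum_{k\ge1}\widehat g(k)\,c_k^{(s)}(n)$$ for complex coefficients $\widehat f(r),\widehat g(k)$. Suppose that $$\sum_{r,k\ge 1}|\widehat f(r)\,\widehat g(k)|\,(r^s,k^s)_s\,\tau_s(r^s)\,\tau_s(k^s)<\infty .$$ Then, as $N\to\infty$, $$\sum_{n\le N} f(n)g(n)\sim N\sum_{r\ge1}\widehat f(r)\,\widehat g(r)\,\Phi_s(r^s).$$
   Context: For a positive integer $s$ and integers $m,n$ not both zero, the generalized gcd $(m,n)_s$ is the largest $l^s$ ($l\in\mathbb N$) dividing both $m$ and $n$; $m,n$ are relatively $s$-prime if $(m,n)_s=1$. The Cohen-Ramanujan sum is $c_r^{(s)}(n)=\sum_{1\le h\le r^s,\ (h,r^s)_s=1} e^{2\pi i n h/r^s}$. Klee's function $\Phi_s(n)$ is the number of $m$ with $1\le m\le n$ and $(m,n)_s=1$. For $s,n\in\mathbb N$, $\tau_s(n)$ is the number of $s$-th powers $l^s$ ($l\in\mathbb N$) dividing $n$. An expansion $f(n)=\sum_r \widehat f(r)c_r^{(s)}(n)$ is absolutely convergent if $\sum_r|\widehat f(r)c_r^{(s)}(n)|<\infty$ for every $n$.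
   Formalization: The relation ~ is proved literally when the series on the right is nonzero; when it is zero (where literal ~ fails, e.g. s=1, f=1, g(n)=(-1)^n) the claim is read as (1/N) times the sum of f(n)g(n) tending to 0. *)

theory Defs
  imports "HOL-Analysis.Analysis" "HOL-Library.Landau_Symbols"
begin

text \<open>Meaningful for \<open>s \<ge> 1\<close> and \<open>m\<close>, \<open>n\<close> not both zero; otherwise there need not be a
  greatest common \<open>s\<close>-th power divisor.\<close>

definition gen_gcd :: "nat \<Rightarrow> int \<Rightarrow> int \<Rightarrow> nat" where
  "gen_gcd s m n = (GREATEST d. \<exists>l\<ge>1. d = l ^ s \<and> int d dvd m \<and> int d dvd n)"

definition cohen_ramanujan_sum :: "nat \<Rightarrow> nat \<Rightarrow> nat \<Rightarrow> complex" where
  "cohen_ramanujan_sum s r n =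
     (\<Sum>h | h \<in> {1..r ^ s} \<and> gen_gcd s (int h) (int (r ^ s)) = 1.
        exp (2 * of_real pi * \<i> * of_nat n * of_nat h / of_nat (r ^ s)))"

definition klee_Phi :: "nat \<Rightarrow> nat \<Rightarrow> nat" where
  "klee_Phi s n = card {m \<in> {1..n}. gen_gcd s (int m) (int n) = 1}"

definition tau_s :: "nat \<Rightarrow> nat \<Rightarrow> nat" where
  "tau_s s n = card {d. (\<exists>l\<ge>1. d = l ^ s) \<and> d dvd n}"

text \<open>Arithmetical functions live on the positive integers, so the value at \<open>0\<close> is unconstrained.\<close>

definition abs_cohen_ramanujan_expansion ::
    "nat \<Rightarrow> (nat \<Rightarrow> complex) \<Rightarrow> (nat \<Rightarrow> complex) \<Rightarrow> bool" where
  "abs_cohen_ramanujan_expansion s f fh \<longleftrightarrow>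
     (\<forall>n\<ge>1. (\<lambda>r. norm (fh r * cohen_ramanujan_sum s r n)) summable_on {1..} \<and>
            f n = (\<Sum>\<^sub>\<infinity>r\<in>{1..}. fh r * cohen_ramanujan_sum s r n))"

end

theory Submission
  imports Defs "HOL-Computational_Algebra.Primes"
begin

text \<open>
  The value \<open>c\<^sub>r(n)\<close> is an alternating sum of terms \<open>d\<^sup>s\<close> over distinct divisors \<open>d\<close> of \<open>r\<close>
  with \<open>d\<^sup>s\<close> dividing \<open>n\<close>. As \<open>1, \<dots>, N\<close> contains at most \<open>N / lcm(d\<^sup>s, e\<^sup>s)\<close> common multiples of \<open>d\<^sup>s\<close>
  and \<open>e\<^sup>s\<close>, the mean of \<open>c\<^sub>r c\<^sub>k\<close> over \<open>n \<le> N\<close> is at most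
  \<open>\<Sum>\<^bsub>d|r, e|k\<^esub> gcd(d, e)\<^sup>s \<le> (r\<^sup>s, k\<^sup>s)\<^sub>s \<tau>\<^sub>s(r\<^sup>s) \<tau>\<^sub>s(k\<^sup>s)\<close>, uniformly in \<open>N\<close>. For fixed \<open>r\<close> and \<open>k\<close> this mean
  converges to \<open>\<Phi>\<^sub>s(r\<^sup>s)\<close> if \<open>r = k\<close> and to \<open>0\<close> otherwise, by orthogonality of the characters
  \<open>n \<mapsto> exp(2\<pi>i n h / r\<^sup>s)\<close>. Dominated convergence over the pairs \<open>(r, k)\<close> gives the mean of \<open>f g\<close>.
\<close>

section \<open>Generalized gcd and counting s-th power divisors\<close>

text \<open>Every common divisor is at most \<open>n\<close> since \<open>n > 0\<close>, and
  \<open>1\<close> is always a candidate; so the \<open>GREATEST\<close> in \<open>gen_gcd\<close>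
  is an attained maximum rather than an unspecified value.\<close>

lemma
  assumes "n > 0"
  shows gen_gcd_witness:
      "\<exists>l\<ge>1. gen_gcd s (int m) (int n) = l ^ s \<and> l ^ s dvd m \<and> l ^ s dvd n"
    and gen_gcd_ge: "l \<ge> 1 \<Longrightarrow> l ^ s dvd m \<Longrightarrow> l ^ s dvd n \<Longrightarrow> l ^ s \<le> gen_gcd s (int m) (int n)"
proof -
  define P where "P = (\<lambda>d. \<exists>l\<ge>1. d = l ^ s \<and> int d dvd int m \<and> int d dvd int n)"
  have eq: "gen_gcd s (int m) (int n) = Greatest P"
    by (simp add: gen_gcd_def P_def)
  have bound: "y \<le> n" if "P y" for y
    using that assms unfolding P_def by (auto intro: dvd_imp_le simp del: of_nat_power)
  have "P 1"
    unfolding P_def by (intro exI[of _ 1]) auto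
  then have "P (Greatest P)"
    using bound by (rule GreatestI_nat)
  then show "\<exists>l\<ge>1. gen_gcd s (int m) (int n) = l ^ s \<and> l ^ s dvd m \<and> l ^ s dvd n"
    unfolding eq by (auto simp: P_def simp del: of_nat_power)
  show "l ^ s \<le> gen_gcd s (int m) (int n)" if "l \<ge> 1" "l ^ s dvd m" "l ^ s dvd n"
  proof -
    have "P (l ^ s)"
      unfolding P_def using that by (intro exI[of _ l]) (auto simp del: of_nat_power)
    then show ?thesis
      unfolding eq using bound by (rule Greatest_le_nat)
  qed
qed

text \<open>Since \<open>l ^ s dvd r ^ s\<close> is equivalent to \<open>l dvd r\<close>, the common
  s-th power divisors can be indexed by divisors of \<open>r\<close> itself.\<close>

lemma gen_gcd_eq_1_iff:
  assumes "s \<ge> 1" "r \<ge> 1"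
  shows "gen_gcd s (int h) (int (r ^ s)) = 1 \<longleftrightarrow> (\<forall>l. l dvd r \<and> l ^ s dvd h \<longrightarrow> l = 1)"
proof
  have pos: "r ^ s > 0"
    using assms by simp
  show "\<forall>l. l dvd r \<and> l ^ s dvd h \<longrightarrow> l = 1" if "gen_gcd s (int h) (int (r ^ s)) = 1"
  proof (intro allI impI, elim conjE)
    fix l assume l: "l dvd r" "l ^ s dvd h"
    have l1: "l \<ge> 1"
      using l assms by (metis One_nat_def Suc_leI dvd_0_left_iff gr0I not_one_le_zero)
    have "l ^ s \<le> 1"
      using gen_gcd_ge[OF pos l1 l(2)] l that by (simp add: dvd_power_same)
    then show "l = 1"
      using l1 assms(1) self_le_power[of l s] by simp
  qed
  show "gen_gcd s (int h) (int (r ^ s)) = 1" if "\<forall>l. l dvd r \<and> l ^ s dvd h \<longrightarrow> l = 1"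
  proof -
    obtain l where l: "gen_gcd s (int h) (int (r ^ s)) = l ^ s" "l ^ s dvd h" "l ^ s dvd r ^ s"
      using gen_gcd_witness[OF pos] by blast
    have "l dvd r"
      using l(3) assms by (simp add: pow_divides_pow_iff)
    then show ?thesis
      using that l by auto
  qed
qed

text \<open>Any \<open>l\<close> other than 1 has a prime factor, so testing primes suffices. This
  is the form to which inclusion-exclusion over sets of primes applies.\<close>

lemma gen_gcd_eq_1_iff_prime:
  assumes "s \<ge> 1" "r \<ge> 1"
  shows "gen_gcd s (int h) (int (r ^ s)) = 1 \<longleftrightarrow> (\<forall>p\<in>prime_factors r. \<not> p ^ s dvd h)"
  unfolding gen_gcd_eq_1_iff[OF assms]
proof (intro iffI ballI allI impI)
  fix p assume "\<forall>l. l dvd r \<and> l ^ s dvd h \<longrightarrow> l = 1" "p \<in> prime_factors r"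
  then show "\<not> p ^ s dvd h"
    by (metis in_prime_factors_iff not_prime_1)
next
  fix l assume p: "\<forall>p\<in>prime_factors r. \<not> p ^ s dvd h" and l: "l dvd r \<and> l ^ s dvd h"
  show "l = 1"
  proof (rule ccontr)
    assume "l \<noteq> 1"
    then obtain p where "prime p" "p dvd l"
      using prime_factor_nat by blast
    moreover from this have "p \<in> prime_factors r" "p ^ s dvd h"
      using l assms by (auto simp: in_prime_factors_iff intro: dvd_trans dvd_power_same)
    ultimately show False
      using p by blast
  qed
qed

text \<open>The map \<open>d\<close> to \<open>d ^ s\<close> is injective and sends divisors of
  \<open>r\<close> to s-th powers dividing \<open>r ^ s\<close>.\<close>

lemma card_divisors_le_tau_s:
  assumes "s \<ge> 1" "r \<ge> 1"
  shows "card {d. d dvd r} \<le> tau_s s (r ^ s)"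
  unfolding tau_s_def
proof (rule card_inj_on_le[of "\<lambda>d. d ^ s"])
  show "inj_on (\<lambda>d. d ^ s) {d. d dvd r}"
    using assms by (intro inj_onI) (metis le_eq_less_or_eq less_le_trans power_eq_iff_eq_base zero_le zero_less_one)
  show "(\<lambda>d. d ^ s) ` {d. d dvd r} \<subseteq> {d. (\<exists>l\<ge>1. d = l ^ s) \<and> d dvd r ^ s}"
    using assms by (auto simp: dvd_power_same) (metis One_nat_def Suc_leI dvd_pos_nat less_eq_Suc_le)
  show "finite {d. (\<exists>l\<ge>1. d = l ^ s) \<and> d dvd r ^ s}"
    using assms by (intro finite_subset[OF _ finite_divisors_nat[of "r ^ s"]]) auto
qed

lemma tau_s_ge_1:
  assumes "s \<ge> 1" "r \<ge> 1"
  shows "tau_s s (r ^ s) \<ge> 1"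
proof -
  have "card {d. d dvd r} \<ge> 1"
    using assms by (metis card_eq_0_iff dvd_refl empty_iff finite_divisors_nat less_eq_Suc_le 
        mem_Collect_eq One_nat_def gr0I)
  then show ?thesis
    using card_divisors_le_tau_s[OF assms] by linarith
qed

section \<open>Divisor formula and pointwise bound for Cohen-Ramanujan sums\<close>

lemma sum_roots_of_unity:
  fixes m n :: nat
  assumes "m \<ge> 1"
  shows "(\<Sum>h=1..m. exp (2 * of_real pi * \<i> * of_nat n * of_nat h / of_nat m)) =
           (if m dvd n then of_nat m else (0::complex))"
proof -
  define z where "z = exp (2 * of_real pi * \<i> * of_nat n / of_nat m)"
  have z: "exp (2 * of_real pi * \<i> * of_nat n * of_nat h / of_nat m) = z ^ h" for h
    unfolding z_def exp_of_nat_mult[symmetric] by (simp add: mult_ac)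
  have z1: "z = 1 \<longleftrightarrow> m dvd n"
    unfolding z_def using complex_root_unity_eq_1[OF assms] by simp
  have "z ^ m = 1"
    unfolding z[symmetric] using assms exp_2pi_1_nat[of n] by (simp add: mult_ac)
  then show ?thesis
    unfolding z using assms z1 by (auto simp: sum_gp)
qed

text \<open>Powers of distinct primes are coprime, so their divisibility conditions combine into
  one.\<close>

lemma prod_power_dvd_iff:
  fixes X :: "nat set"
  assumes "finite X" "\<And>p. p \<in> X \<Longrightarrow> prime p"
  shows "(\<Prod>X) ^ s dvd h \<longleftrightarrow> (\<forall>p\<in>X. p ^ s dvd h)"
  using assms
proof (induction X rule: finite_induct)
  case (insert p X)
  have "coprime p (\<Prod>X)"
    using insert by (intro prod_coprime_right) (auto intro: primes_coprime)
  then have "coprime (p ^ s) ((\<Prod>X) ^ s)"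
    by simp
  then have "p ^ s * (\<Prod>X) ^ s dvd h \<longleftrightarrow> p ^ s dvd h \<and> (\<Prod>X) ^ s dvd h"
    by (meson divides_mult dvd_mult_left dvd_mult_right)
  then show ?case
    using insert by (simp add: power_mult_distrib)
qed auto

text \<open>A set of primes is recovered from its product as the set of prime divisors of that
  product.\<close>

lemma prod_primes_inj:
  fixes X Y :: "nat set"
  assumes "finite X" "\<And>p. p \<in> X \<Longrightarrow> prime p" "finite Y" "\<And>p. p \<in> Y \<Longrightarrow> prime p"
    and "\<Prod>X = \<Prod>Y"
  shows "X = Y"
proof -
  have "X = {p. prime p \<and> p dvd \<Prod>X}" if "finite X" "\<And>p. p \<in> X \<Longrightarrow> prime p" for X :: "nat set"
    using that by (auto simp: prime_dvd_prod_iff) (metis primes_dvd_imp_eq)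
  then show ?thesis
    using assms by metis
qed

lemma prod_primes_dvd:
  fixes X :: "nat set"
  assumes "X \<subseteq> prime_factors r"
  shows "\<Prod>X dvd r"
proof -
  have "finite X"
    using assms by (rule finite_subset) simp
  then show ?thesis
    using assms prod_power_dvd_iff[of X 1 r] by (auto simp: in_prime_factors_iff subset_iff)
qed

text \<open>This is the formula c_r(n) = sum of mu(r/d) d^s over \<open>d\<close> dividing
  \<open>r\<close> with \<open>d ^ s dvd n\<close>. The squarefree quotients r/d are encoded as
  products of sets \<open>X\<close> of prime factors, with \<open>(-1) ^ card X\<close> as the
  Moebius value.\<close>

lemma cohen_ramanujan_sum_inclusion_exclusion:
  assumes "s \<ge> 1" "r \<ge> 1"
  shows "cohen_ramanujan_sum s r n =
    (\<Sum>X\<in>Pow (prime_factors r). (-1) ^ card X *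
       (if (r div \<Prod>X) ^ s dvd n then of_nat ((r div \<Prod>X) ^ s) else 0))"
proof -
  define P where "P = prime_factors r"
  define e where "e h = exp (2 * of_real pi * \<i> * of_nat n * of_nat h / of_nat (r ^ s))" for h
  have fin: "finite P" and prime: "p \<in> P \<Longrightarrow> prime p" for p
    by (auto simp: P_def)
  \<comment> \<open>Inclusion-exclusion, by multiplying out the product over \<open>p\<close> in
    \<open>P\<close> of one minus the indicator of \<open>p ^ s dvd h\<close>.\<close>
  have ind: "of_bool (\<forall>p\<in>P. \<not> p ^ s dvd h) =
      (\<Sum>X\<in>Pow P. (-1) ^ card X * of_bool ((\<Prod>X) ^ s dvd h) :: complex)" for h
  proof -
    have "of_bool (\<forall>p\<in>P. \<not> p ^ s dvd h) = (\<Prod>p\<in>P. - of_bool (p ^ s dvd h) + 1 :: complex)"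
    proof (cases "\<forall>p\<in>P. \<not> p ^ s dvd h")
      case False
      then have "(\<Prod>p\<in>P. - of_bool (p ^ s dvd h) + 1 :: complex) = 0"
        using fin by (intro prod_zero) auto
      with False show ?thesis by simp
    qed auto
    also have "\<dots> = (\<Sum>X\<in>Pow P. (\<Prod>p\<in>X. - of_bool (p ^ s dvd h)))"
      using prod_add[OF fin, of "\<lambda>p. - of_bool (p ^ s dvd h)" "\<lambda>_. 1 :: complex"] by simp
    also have "\<dots> = (\<Sum>X\<in>Pow P. (-1) ^ card X * of_bool ((\<Prod>X) ^ s dvd h))"
    proof (rule sum.cong[OF refl])
      fix X assume "X \<in> Pow P"
      then have X: "finite X" "\<And>p. p \<in> X \<Longrightarrow> prime p"
        using fin prime by (auto intro: finite_subset)
      have "(\<Prod>p\<in>X. of_bool (p ^ s dvd h)) = (of_bool (\<forall>p\<in>X. p ^ s dvd h) :: complex)"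
        using X(1) by (induction X rule: finite_induct) auto
      then show "(\<Prod>p\<in>X. - of_bool (p ^ s dvd h)) =
          ((-1) ^ card X * of_bool ((\<Prod>X) ^ s dvd h) :: complex)"
        using prod_power_dvd_iff[OF X] by (simp add: prod_uminus)
    qed
    finally show ?thesis .
  qed
  \<comment> \<open>With \<open>q = \<Prod>X\<close> and \<open>r = q * d\<close>, substituting
    \<open>h = q ^ s * j\<close> leaves a complete sum of roots of unity of order
    \<open>d ^ s\<close>.\<close>
  have inner: "(\<Sum>h=1..r ^ s. of_bool ((\<Prod>X) ^ s dvd h) * e h) =
      (if (r div \<Prod>X) ^ s dvd n then of_nat ((r div \<Prod>X) ^ s) else 0)"
    if "X \<in> Pow P" for X
  proof -
    define q where "q = \<Prod>X"
    define d where "d = r div q"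
    have r: "r = q * d"
      using prod_primes_dvd[of X r] that by (auto simp: P_def q_def d_def)
    have q: "q > 0" and d: "d \<ge> 1"
      using r assms(2) by (auto intro: Nat.gr0I simp: Suc_le_eq)
    have "(\<Sum>h=1..r ^ s. of_bool (q ^ s dvd h) * e h) = (\<Sum>h | h \<in> {1..r ^ s} \<and> q ^ s dvd h. e h)"
      by (intro sum.mono_neutral_cong_right) auto
    also have "\<dots> = (\<Sum>j=1..d ^ s. e (q ^ s * j))"
    proof (rule sum.reindex_bij_witness[of _ "\<lambda>j. q ^ s * j" "\<lambda>h. h div q ^ s"])
      fix h assume "h \<in> {h. h \<in> {1..r ^ s} \<and> q ^ s dvd h}"
      then obtain j where h: "h = q ^ s * j" "1 \<le> q ^ s * j" "q ^ s * j \<le> q ^ s * d ^ s"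
        unfolding r power_mult_distrib by (metis (lifting) atLeastAtMost_iff dvdE mem_Collect_eq)
      then show "h div q ^ s \<in> {1..d ^ s}" "q ^ s * (h div q ^ s) = h"
          "e (q ^ s * (h div q ^ s)) = e h"
        using q by (auto simp: Suc_le_eq)
    qed (use q in \<open>auto simp: r power_mult_distrib Suc_le_eq\<close>)
    also have "\<dots> = (\<Sum>j=1..d ^ s. exp (2 * of_real pi * \<i> * of_nat n * of_nat j / of_nat (d ^ s)))"
      using q d by (intro sum.cong) (auto simp: e_def r power_mult_distrib field_simps)
    also have "\<dots> = (if d ^ s dvd n then of_nat (d ^ s) else 0)"
      by (rule sum_roots_of_unity) (use d in auto)
    finally show ?thesis
      by (simp add: d_def q_def)
  qed
  have "cohen_ramanujan_sum s r n = (\<Sum>h | h \<in> {1..r ^ s} \<and> (\<forall>p\<in>P. \<not> p ^ s dvd h). e h)"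
    unfolding cohen_ramanujan_sum_def gen_gcd_eq_1_iff_prime[OF assms] P_def e_def ..
  also have "\<dots> = (\<Sum>h=1..r ^ s. of_bool (\<forall>p\<in>P. \<not> p ^ s dvd h) * e h)"
    by (intro sum.mono_neutral_cong_left) auto
  also have "\<dots> = (\<Sum>h=1..r ^ s. \<Sum>X\<in>Pow P. (-1) ^ card X * (of_bool ((\<Prod>X) ^ s dvd h) * e h))"
    unfolding ind by (simp add: sum_distrib_right mult.assoc)
  also have "\<dots> = (\<Sum>X\<in>Pow P. (-1) ^ card X * (\<Sum>h=1..r ^ s. of_bool ((\<Prod>X) ^ s dvd h) * e h))"
    unfolding sum_distrib_left by (rule sum.swap)
  finally show ?thesis
    using inner by (simp add: P_def)
qed

text \<open>Different sets \<open>X\<close> give different divisors \<open>r div \<Prod>X\<close>,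
  so after the triangle inequality each divisor of \<open>r\<close> is counted at most once.\<close>

lemma norm_cohen_ramanujan_sum_le:
  assumes "s \<ge> 1" "r \<ge> 1"
  shows "norm (cohen_ramanujan_sum s r n) \<le> (\<Sum>d | d dvd r. of_bool (d ^ s dvd n) * real (d ^ s))"
proof -
  let ?P = "prime_factors r" and ?b = "\<lambda>d. of_bool (d ^ s dvd n) * real (d ^ s)"
  have "norm (cohen_ramanujan_sum s r n) \<le> (\<Sum>X\<in>Pow ?P. ?b (r div \<Prod>X))"
    unfolding cohen_ramanujan_sum_inclusion_exclusion[OF assms]
    by (intro sum_norm_le) (auto simp: norm_mult norm_power)
  also have "\<dots> = sum ?b ((\<lambda>X. r div \<Prod>X) ` Pow ?P)"
  proof (subst sum.reindex)
    show "inj_on (\<lambda>X. r div \<Prod>X) (Pow ?P)"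
    proof (rule inj_onI)
      fix X Y assume X: "X \<in> Pow ?P" and Y: "Y \<in> Pow ?P" and eq: "r div \<Prod>X = r div \<Prod>Y"
      have "\<Prod>X * (r div \<Prod>X) = r" "\<Prod>Y * (r div \<Prod>X) = r"
        using X Y prod_primes_dvd[of X r] prod_primes_dvd[of Y r] by (simp, simp add: eq)
      then have "\<Prod>X = \<Prod>Y"
        using assms(2) by (metis mult_cancel2 mult_0_right not_one_le_zero)
      with X Y show "X = Y"
        by (intro prod_primes_inj) (auto intro: finite_subset)
    qed
  qed simp
  also have "\<dots> \<le> (\<Sum>d | d dvd r. ?b d)"
  proof (rule sum_mono2)
    show "finite {d. d dvd r}"
      using assms by simp
    show "(\<lambda>X. r div \<Prod>X) ` Pow ?P \<subseteq> {d. d dvd r}"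
      using prod_primes_dvd by (auto intro: div_dvd_div simp: div_dvd_iff_mult) (metis dvd_div_mult_self dvd_triv_left)
  qed auto
  finally show ?thesis .
qed


section \<open>Bound for the means of products, uniform in \<open>N\<close>\<close>

lemma card_multiples_mult_le:
  fixes m N :: nat
  shows "card {n \<in> {1..N}. m dvd n} * m \<le> N"
proof (cases "m = 0")
  case False
  have "{n \<in> {1..N}. m dvd n} \<subseteq> (\<lambda>j. m * j) ` {1..N div m}"
  proof
    fix n assume "n \<in> {n \<in> {1..N}. m dvd n}"
    then obtain j where "n = m * j" "1 \<le> m * j" "m * j \<le> N"
      by (metis (lifting) atLeastAtMost_iff dvdE mem_Collect_eq)
    with False show "n \<in> (\<lambda>j. m * j) ` {1..N div m}"
      by (auto simp: less_eq_div_iff_mult_less_eq Suc_le_eq mult.commute)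
  qed
  then have "card {n \<in> {1..N}. m dvd n} \<le> card ((\<lambda>j. m * j) ` {1..N div m})"
    by (intro card_mono) auto
  also have "\<dots> \<le> N div m"
    using card_image_le[of "{1..N div m}" "\<lambda>j. m * j"] by simp
  finally show ?thesis
    by (rule order_trans[OF mult_le_mono1 div_times_less_eq_dividend])
qed simp

text \<open>Common multiples of \<open>a\<close> and \<open>b\<close> are multiples of
  \<open>lcm a b\<close>, and \<open>a * b = gcd a b * lcm a b\<close>.\<close>

lemma mult_card_common_multiples_le:
  fixes a b N :: nat
  shows "a * b * card {n \<in> {1..N}. a dvd n \<and> b dvd n} \<le> N * gcd a b"
proof -
  have "a * b * card {n \<in> {1..N}. a dvd n \<and> b dvd n} =
      gcd a b * (card {n \<in> {1..N}. lcm a b dvd n} * lcm a b)"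
    unfolding prod_gcd_lcm_nat[of a b] by (simp only: lcm_least_iff mult_ac)
  also have "\<dots> \<le> gcd a b * N"
    by (intro mult_left_mono card_multiples_mult_le) auto
  finally show ?thesis
    by (simp add: mult.commute)
qed

text \<open>Supplies the dominating function. Each pair of divisors \<open>d\<close>,
  \<open>e\<close> contributes at most \<open>N * gcd d e ^ s\<close>, which is bounded by
  \<open>N\<close> times the generalized gcd, and the \<open>tau_s\<close> factors bound the number
  of pairs.\<close>

lemma norm_sum_cohen_ramanujan_sum_mult_le:
  assumes s: "s \<ge> 1" and r: "r \<ge> 1" and k: "k \<ge> 1"
  shows "norm (\<Sum>n=1..N. cohen_ramanujan_sum s r n * cohen_ramanujan_sum s k n) \<le>
    real N * (real (gen_gcd s (int (r ^ s)) (int (k ^ s))) * real (tau_s s (r ^ s)) * real (tau_s s (k ^ s)))"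
proof -
  define G where "G = real (gen_gcd s (int (r ^ s)) (int (k ^ s)))"
  have term_le: "real (d ^ s) * real (e ^ s) * real (card {n \<in> {1..N}. d ^ s dvd n \<and> e ^ s dvd n}) \<le> real N * G"
    if "d dvd r" "e dvd k" for d e
  proof -
    \<comment> \<open>These facts make \<open>gcd d e ^ s\<close> an admissible common s-th power
      divisor of \<open>r ^ s\<close> and \<open>k ^ s\<close>.\<close>
    have g: "gcd d e dvd r" "gcd d e dvd k" "gcd d e \<ge> 1"
      using that r by (auto intro: dvd_trans simp: Suc_le_eq)
    have "d ^ s * e ^ s * card {n \<in> {1..N}. d ^ s dvd n \<and> e ^ s dvd n} \<le> N * gcd d e ^ s"
      using mult_card_common_multiples_le[of "d ^ s" "e ^ s" N] by (simp add: gcd_exp)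
    also have "\<dots> \<le> N * gen_gcd s (int (r ^ s)) (int (k ^ s))"
      using g k by (intro mult_left_mono gen_gcd_ge) (auto intro: dvd_power_same)
    finally show ?thesis
      unfolding G_def by (simp only: of_nat_mult[symmetric] of_nat_le_iff)
  qed
  have "norm (\<Sum>n=1..N. cohen_ramanujan_sum s r n * cohen_ramanujan_sum s k n) \<le>
      (\<Sum>n=1..N. (\<Sum>d | d dvd r. of_bool (d ^ s dvd n) * real (d ^ s)) *
                  (\<Sum>e | e dvd k. of_bool (e ^ s dvd n) * real (e ^ s)))"
    by (intro order_trans[OF norm_sum] sum_mono, unfold norm_mult)
       (intro mult_mono norm_cohen_ramanujan_sum_le assms sum_nonneg; simp)
  also have "\<dots> = (\<Sum>n=1..N. \<Sum>d | d dvd r. \<Sum>e | e dvd k.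
      real (d ^ s) * real (e ^ s) * of_bool (d ^ s dvd n \<and> e ^ s dvd n))"
    unfolding sum_product by (intro sum.cong) auto
  also have "\<dots> = (\<Sum>d | d dvd r. \<Sum>e | e dvd k. \<Sum>n=1..N.
      real (d ^ s) * real (e ^ s) * of_bool (d ^ s dvd n \<and> e ^ s dvd n))"
    by (subst sum.swap, rule sum.cong[OF refl], rule sum.swap)
  also have "\<dots> = (\<Sum>d | d dvd r. \<Sum>e | e dvd k.
      real (d ^ s) * real (e ^ s) * real (card {n \<in> {1..N}. d ^ s dvd n \<and> e ^ s dvd n}))"
    unfolding sum_distrib_left[symmetric] by (simp add: sum.If_cases of_bool_def Int_def)
  also have "\<dots> \<le> (\<Sum>d | d dvd r. \<Sum>e | e dvd k. real N * G)"
    by (intro sum_mono term_le) auto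
  also have "\<dots> = real N * (G * real (card {d. d dvd r}) * real (card {e. e dvd k}))"
    by simp
  also have "\<dots> \<le> real N * (G * real (tau_s s (r ^ s)) * real (tau_s s (k ^ s)))"
    using card_divisors_le_tau_s[OF s r] card_divisors_le_tau_s[OF s k]
    by (intro mult_left_mono mult_mono) (auto simp: G_def)
  finally show ?thesis
    by (simp add: G_def)
qed

section \<open>Limits of the means by orthogonality of characters\<close>

text \<open>For \<open>z \<noteq> 1\<close> the geometric sums stay bounded by
  \<open>2 / norm (1 - z)\<close>, so division by \<open>N\<close> sends them to 0.\<close>

lemma mean_powers_unit_tendsto:
  fixes z :: complex
  assumes "norm z = 1"
  shows "(\<lambda>N. (\<Sum>n=1..N. z ^ n) / of_nat N) \<longlonglongrightarrow> of_bool (z = 1)"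
proof (cases "z = 1")
  case True
  \<comment> \<open>The mean is 1 only from \<open>N = 1\<close> on; at \<open>N = 0\<close> the
    quotient has the value 0.\<close>
  have "eventually (\<lambda>N. (\<Sum>n=1..N. z ^ n) / of_nat N = 1) sequentially"
    using eventually_gt_at_top[of 0] by eventually_elim (simp add: True)
  then show ?thesis
    using True by (simp add: tendsto_eventually)
next
  case False
  have bound: "norm ((\<Sum>n=1..N. z ^ n) / of_nat N) \<le> (2 / norm (1 - z)) * (1 / real N)" for N
  proof -
    have "norm (z - z ^ Suc N) \<le> 2"
      using norm_triangle_ineq4[of z "z ^ Suc N"] assms by (simp add: norm_mult norm_power)
    then have "norm (\<Sum>n=1..N. z ^ n) \<le> 2 / norm (1 - z)"
      using False by (auto simp: sum_gp norm_divide intro!: divide_right_mono)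
    then show ?thesis
      using divide_right_mono[of "norm (\<Sum>n=1..N. z ^ n)" "2 / norm (1 - z)" "real N"]
      by (simp add: norm_divide)
  qed
  have "(\<lambda>N. (2 / norm (1 - z)) * (1 / real N)) \<longlonglongrightarrow> 0"
    by (rule tendsto_eq_intros lim_1_over_n refl)+ simp
  with always_eventually[OF allI[OF bound]]
  have "(\<lambda>N. (\<Sum>n=1..N. z ^ n) / of_nat N) \<longlonglongrightarrow> 0"
    by (rule Lim_null_comparison)
  with False show ?thesis
    by simp
qed

text \<open>The hypothesis \<open>dvd\<close> says that h/r^s + h'/k^s is an integer. Cancelling the
  gcd, the reduced part \<open>a\<close> of \<open>r\<close> satisfies \<open>a ^ s dvd h\<close>
  and \<open>a dvd r\<close>, so relative s-primality forces \<open>a = 1\<close>.\<close>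

lemma dvd_of_rel_prime_fractions_sum_int:
  assumes s: "s \<ge> 1" and r: "r \<ge> 1" and k: "k \<ge> 1"
    and h: "gen_gcd s (int h) (int (r ^ s)) = 1"
    and dvd: "r ^ s * k ^ s dvd h * k ^ s + h' * r ^ s"
  shows "r dvd k"
proof -
  define g where "g = gcd r k"
  obtain a b where ab: "r = a * g" "k = b * g" "coprime a b"
    using gcd_coprime_exists[of r k] r unfolding g_def by auto
  have g: "g > 0"
    using r by (simp add: g_def)
  have "r ^ s dvd h * k ^ s + h' * r ^ s"
    using dvd by (rule dvd_mult_left)
  then have "r ^ s dvd h * k ^ s"
    by (simp add: dvd_add_left_iff)
  then have "g ^ s * a ^ s dvd g ^ s * (h * b ^ s)"
    by (simp add: ab power_mult_distrib mult_ac)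
  then have "a ^ s dvd h * b ^ s"
    using g by simp
  then have "a ^ s dvd h"
    using ab(3) by (simp add: coprime_dvd_mult_left_iff)
  moreover have "a dvd r"
    by (simp add: ab)
  ultimately have "a = 1"
    using h gen_gcd_eq_1_iff[OF s r] by blast
  then show ?thesis
    by (simp add: ab)
qed

text \<open>The one solution is the residue of \<open>- h\<close>, and negation modulo
  \<open>r ^ s\<close> preserves relative s-primality to \<open>r ^ s\<close>. Thus each
  \<open>h\<close> has exactly one partner in the diagonal case.\<close>

lemma card_opposite_rel_prime_residue:
  assumes s: "s \<ge> 1" and r: "r \<ge> 1"
    and h: "h \<in> {1..r ^ s}" "gen_gcd s (int h) (int (r ^ s)) = 1"
  shows "card {h'. (h' \<in> {1..r ^ s} \<and> gen_gcd s (int h') (int (r ^ s)) = 1) \<and> r ^ s dvd h + h'} = 1"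
proof -
  define m where "m = r ^ s"
  \<comment> \<open>Representatives run over \<open>1, ..., m\<close>, so for \<open>h = m\<close>
    the negative is \<open>m\<close>, not 0.\<close>
  define h0 where "h0 = (if h < m then m - h else m)"
  have hm: "1 \<le> h" "h \<le> m"
    using h by (auto simp: m_def)
  have h0: "h0 \<in> {1..m}" "m dvd h + h0"
    using hm by (auto simp: h0_def)
  have cop: "gen_gcd s (int h0) (int m) = 1"
    unfolding m_def gen_gcd_eq_1_iff[OF s r]
  proof (intro allI impI, elim conjE)
    fix l assume l: "l dvd r" "l ^ s dvd h0"
    then have "l ^ s dvd h + h0"
      using h0(2) unfolding m_def by (meson dvd_power_same dvd_trans)
    then have "l ^ s dvd h"
      using l by (simp add: dvd_add_left_iff)
    then show "l = 1"
      using l h gen_gcd_eq_1_iff[OF s r] by blast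
  qed
  have uniq: "h' = h0" if h': "h' \<in> {1..m}" "m dvd h + h'" for h'
  proof -
    obtain t where t: "h + h' = m * t"
      using h'(2) by (elim dvdE)
    have "m > 0"
      using hm by simp
    moreover have "m * t \<le> m * 2"
      unfolding t[symmetric] using hm h' by simp
    moreover have "m * t > 0"
      unfolding t[symmetric] using hm by simp
    \<comment> \<open>The value \<open>t = 2\<close> occurs only for \<open>h = h' = m\<close>,
      which matches the second branch of \<open>h0\<close>.\<close>
    ultimately have "t = 1 \<or> t = 2"
      by auto
    then show ?thesis
      using t hm h' by (auto simp: h0_def split: if_splits)
  qed
  have "{h'. (h' \<in> {1..m} \<and> gen_gcd s (int h') (int m) = 1) \<and> m dvd h + h'} = {h0}"
    using h0 cop uniq by blast
  then show ?thesis
    by (simp add: m_def)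
qed

text \<open>The product of the two sums is a double sum of powers \<open>z h h' ^ n\<close> with
  \<open>z h h'\<close> on the unit circle. Hence the limit counts the pairs with
  \<open>z h h' = 1\<close>: one for each \<open>h\<close> if \<open>r = k\<close>, none
  otherwise.\<close>

lemma mean_cohen_ramanujan_sum_mult_tendsto:
  assumes s: "s \<ge> 1" and r: "r \<ge> 1" and k: "k \<ge> 1"
  shows "(\<lambda>N. (\<Sum>n=1..N. cohen_ramanujan_sum s r n * cohen_ramanujan_sum s k n) / of_nat N)
    \<longlonglongrightarrow> (if r = k then of_nat (klee_Phi s (r ^ s)) else 0)"
proof -
  define U where "U r = {h. h \<in> {1..r ^ s} \<and> gen_gcd s (int h) (int (r ^ s)) = 1}" for r
  have finU: "finite (U q)" for q
    by (simp add: U_def)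
  define z where "z h h' = exp (2 * of_real pi * \<i> * of_nat (h * k ^ s + h' * r ^ s) / of_nat (r ^ s * k ^ s))"
    for h h'
  have z_norm: "norm (z h h') = 1" for h h'
    unfolding z_def by simp
  have pos: "1 \<le> r ^ s * k ^ s"
    using r k by simp
  have z1: "z h h' = 1 \<longleftrightarrow> r ^ s * k ^ s dvd h * k ^ s + h' * r ^ s" for h h'
    unfolding z_def by (rule complex_root_unity_eq_1[OF pos])
  have "cohen_ramanujan_sum s r n * cohen_ramanujan_sum s k n = (\<Sum>h\<in>U r. \<Sum>h'\<in>U k. z h h' ^ n)" for n
  proof -
    have "exp (2 * of_real pi * \<i> * of_nat n * of_nat h / of_nat (r ^ s)) *
        exp (2 * of_real pi * \<i> * of_nat n * of_nat h' / of_nat (k ^ s)) = z h h' ^ n" for h h'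
      unfolding z_def exp_of_nat_mult[symmetric] exp_add[symmetric]
      using r k by (intro arg_cong[of _ _ exp]) (simp add: field_simps)
    then show ?thesis
      unfolding cohen_ramanujan_sum_def U_def[symmetric] sum_product by simp
  qed
  then have eq: "(\<Sum>n=1..N. cohen_ramanujan_sum s r n * cohen_ramanujan_sum s k n) / of_nat N =
      (\<Sum>h\<in>U r. \<Sum>h'\<in>U k. (\<Sum>n=1..N. z h h' ^ n) / of_nat N)" for N
    unfolding sum_divide_distrib[symmetric]
    by (simp only:) (subst sum.swap, rule arg_cong[of _ _ "\<lambda>x. x / of_nat N"], rule sum.cong[OF refl], rule sum.swap)
  have "(\<lambda>N. \<Sum>h\<in>U r. \<Sum>h'\<in>U k. (\<Sum>n=1..N. z h h' ^ n) / of_nat N)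
      \<longlonglongrightarrow> (\<Sum>h\<in>U r. \<Sum>h'\<in>U k. of_bool (z h h' = 1))"
    by (intro tendsto_sum mean_powers_unit_tendsto z_norm)
  also have "(\<Sum>h\<in>U r. \<Sum>h'\<in>U k. of_bool (z h h' = 1)) =
      (if r = k then of_nat (klee_Phi s (r ^ s)) else (0 :: complex))"
  proof (cases "r = k")
    case True
    have z1': "z h h' = 1 \<longleftrightarrow> r ^ s dvd h + h'" for h h'
      unfolding z1 True[symmetric] using r by (simp add: distrib_right[symmetric])
    have "(\<Sum>h'\<in>U k. of_bool (z h h' = 1)) = (1 :: complex)" if "h \<in> U r" for h
    proof -
      have "(\<Sum>h'\<in>U k. of_bool (z h h' = 1)) =
          (of_nat (card {h'. h' \<in> U r \<and> r ^ s dvd h + h'}) :: complex)"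
        unfolding z1' True[symmetric] using finU by (simp add: of_bool_def sum.If_cases Int_def)
      also have "card {h'. h' \<in> U r \<and> r ^ s dvd h + h'} = 1"
        using card_opposite_rel_prime_residue[OF s r, of h] that by (simp add: U_def)
      finally show ?thesis by simp
    qed
    then show ?thesis
      using True by (simp add: klee_Phi_def U_def)
  next
    case False
    have "z h h' \<noteq> 1" if "h \<in> U r" "h' \<in> U k" for h h'
    proof
      assume "z h h' = 1"
      \<comment> \<open>The same divisibility, written with the roles of \<open>r\<close> and
        \<open>k\<close> exchanged, gives divisibility in both directions.\<close>
      then have "r ^ s * k ^ s dvd h * k ^ s + h' * r ^ s" "k ^ s * r ^ s dvd h' * r ^ s + h * k ^ s"
        unfolding z1 by (simp_all add: mult.commute add.commute)
      then have "r dvd k" "k dvd r"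
        using that dvd_of_rel_prime_fractions_sum_int[OF s r k] dvd_of_rel_prime_fractions_sum_int[OF s k r]
        unfolding U_def by blast+
      with False show False
        by (simp add: dvd_antisym)
    qed
    then show ?thesis
      using False by simp
  qed
  finally show ?thesis
    unfolding eq .
qed

section \<open>Dominated convergence and products for unordered sums\<close>

text \<open>Dominated convergence for the Bochner integral over the counting measure, carried over
  to \<open>infsum\<close> through \<open>infsetsum\<close>.\<close>

lemma infsum_dominated_convergence:
  fixes f :: "'a \<Rightarrow> 'b :: {banach, second_countable_topology}"
  assumes w: "w summable_on A"
    and lim: "\<And>x. x \<in> A \<Longrightarrow> (\<lambda>i. u i x) \<longlonglongrightarrow> f x"
    and bound: "\<And>i x. x \<in> A \<Longrightarrow> norm (u i x) \<le> w x"
  shows "(\<lambda>i. infsum (u i) A) \<longlonglongrightarrow> infsum f A"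
proof -
  have nonneg: "0 \<le> w x" if "x \<in> A" for x
    using bound[OF that, of 0] norm_ge_zero order_trans by blast
  have "(\<lambda>x. norm (w x)) summable_on A"
    using w nonneg by (subst summable_on_cong[of _ _ w]) auto
  then have "Infinite_Set_Sum.abs_summable_on w A"
    unfolding abs_summable_equivalent .
  then have int: "integrable (count_space A) w"
    by (simp add: Infinite_Set_Sum.abs_summable_on_def)
  have AE_lim: "AE x in count_space A. (\<lambda>i. u i x) \<longlonglongrightarrow> f x"
    and AE_bound: "\<And>i. AE x in count_space A. norm (u i x) \<le> w x"
    using lim bound by (auto simp: AE_count_space)
  note dc = integrable_dominated_convergence[OF _ _ int AE_lim AE_bound]
    integrable_dominated_convergence2[OF _ _ int AE_lim AE_bound]
    integral_dominated_convergence[OF _ _ int AE_lim AE_bound]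
  have "(\<lambda>i. infsetsum (u i) A) \<longlonglongrightarrow> infsetsum f A"
    unfolding infsetsum_def by (rule dc) simp_all
  moreover have "infsetsum f A = infsum f A"
    by (rule infsetsum_infsum) (unfold Infinite_Set_Sum.abs_summable_on_def, rule dc, simp_all)
  moreover have "infsetsum (u i) A = infsum (u i) A" for i
    by (rule infsetsum_infsum) (unfold Infinite_Set_Sum.abs_summable_on_def, rule dc, simp_all)
  ultimately show ?thesis
    by simp
qed

text \<open>Absolute summability of both factors makes the product family absolutely summable on
  \<open>A \<times> B\<close>, so iterated summation is justified and the factors separate.\<close>

lemma has_sum_product_abs:
  fixes a b :: "'a \<Rightarrow> complex"
  assumes a: "(\<lambda>x. norm (a x)) summable_on A" and b: "(\<lambda>y. norm (b y)) summable_on B"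
  shows "((\<lambda>(x, y). a x * b y) has_sum infsum a A * infsum b B) (A \<times> B)"
proof -
  have "(\<lambda>z. norm (case z of (x, y) \<Rightarrow> a x * b y)) summable_on (A \<times> B)"
    using a b
    by (subst Infinite_Sum.abs_summable_on_Sigma_iff)
       (auto simp: norm_mult infsum_cmult_right' abs_mult infsum_nonneg
             intro!: summable_on_cmult_right summable_on_cmult_left)
  then have sum: "(\<lambda>(x, y). a x * b y) summable_on (A \<times> B)"
    by (rule abs_summable_summable)
  have "infsum (\<lambda>(x, y). a x * b y) (A \<times> B) = (\<Sum>\<^sub>\<infinity>x\<in>A. \<Sum>\<^sub>\<infinity>y\<in>B. a x * b y)"
    using infsum_Sigma'_banach[OF sum] by simp
  also have "\<dots> = infsum a A * infsum b B"
    by (simp add: infsum_cmult_right' infsum_cmult_left')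
  finally show ?thesis
    using sum by (simp add: has_sum_iff)
qed

lemma has_sum_finite_sum:
  fixes F :: "'i \<Rightarrow> 'a \<Rightarrow> 'b :: {topological_comm_monoid_add}"
  assumes "\<And>i. i \<in> I \<Longrightarrow> (F i has_sum S i) A"
  shows "((\<lambda>x. \<Sum>i\<in>I. F i x) has_sum (\<Sum>i\<in>I. S i)) A"
  using assms by (induction I rule: infinite_finite_induct) (auto intro!: has_sum_add)

section \<open>Mean value of the product of two expansions\<close>

text \<open>The summability conjunct ensures that \<open>C\<close> is a genuine sum rather than the
  default value 0 of \<open>infsum\<close>. The limit of means covers every \<open>C\<close>; the
  equivalence is stated for \<open>C \<noteq> 0\<close>, since equivalence to the zero function
  would force the partial sums to vanish eventually.\<close>

theorem theorem1p1:
  fixes s :: nat and f g fh gh :: "nat \<Rightarrow> complex"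
  assumes "s \<ge> 1"
    and "abs_cohen_ramanujan_expansion s f fh"
    and "abs_cohen_ramanujan_expansion s g gh"
    and "(\<lambda>(r, k). norm (fh r * gh k) * real (gen_gcd s (int (r ^ s)) (int (k ^ s)))
            * real (tau_s s (r ^ s)) * real (tau_s s (k ^ s)))
          summable_on ({1..} \<times> {1..})"
  shows "(\<lambda>r. norm (fh r * gh r * of_nat (klee_Phi s (r ^ s)))) summable_on {1..}
    \<and> (let C = (\<Sum>\<^sub>\<infinity>r\<in>{1..}. fh r * gh r * of_nat (klee_Phi s (r ^ s))) in
          (\<lambda>N. (\<Sum>n=1..N. f n * g n) / of_nat N) \<longlonglongrightarrow> C
        \<and> (C \<noteq> 0 \<longrightarrow> (\<lambda>N. \<Sum>n=1..N. f n * g n) \<sim>[at_top] (\<lambda>N. of_nat N * C)))"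
proof -
  note s = assms(1)
  define I :: "nat set" where "I = {1..}"
  define G where "G r k = real (gen_gcd s (int (r ^ s)) (int (k ^ s)))
            * real (tau_s s (r ^ s)) * real (tau_s s (k ^ s))" for r k
  define w where "w = (\<lambda>(r, k). norm (fh r * gh k) * G r k)"
  define c where "c = cohen_ramanujan_sum s"
  define C where "C = (\<Sum>\<^sub>\<infinity>r\<in>I. fh r * gh r * of_nat (klee_Phi s (r ^ s)))"
  define u where "u N = (\<lambda>(r, k). fh r * gh k * ((\<Sum>n=1..N. c r n * c k n) / of_nat N))" for N :: nat
  define v where "v = (\<lambda>(r, k). if r = k then fh r * gh r * of_nat (klee_Phi s (r ^ s)) else 0)"
  have w: "w summable_on I \<times> I"
    using assms(4) by (simp add: w_def I_def G_def mult.assoc)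

  have diag: "inj_on (\<lambda>r. (r, r)) I"
    by (auto intro: inj_onI)
  \<comment> \<open>Restricting the hypothesis to the diagonal \<open>r = k\<close> yields absolute
    convergence of the series for \<open>C\<close>.\<close>
  have "w summable_on (\<lambda>r. (r, r)) ` I"
    using w by (rule summable_on_subset_banach) auto
  then have "(\<lambda>r. w (r, r)) summable_on I"
    by (simp add: summable_on_reindex[OF diag] o_def)
  then have abs: "(\<lambda>r. norm (fh r * gh r * of_nat (klee_Phi s (r ^ s)))) summable_on I"
  proof (rule summable_on_comparison_test)
    fix r assume "r \<in> I"
    then have r: "r \<ge> 1"
      by (simp add: I_def)
    have "card {m \<in> {1..r ^ s}. gen_gcd s (int m) (int (r ^ s)) = 1} \<le> card {1..r ^ s}"
      by (intro card_mono) auto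
    then have "klee_Phi s (r ^ s) \<le> r ^ s"
      by (simp add: klee_Phi_def)
    \<comment> \<open>On the diagonal \<open>r ^ s\<close> is itself a common s-th power divisor;
      the two \<open>tau_s\<close> factors are at least 1.\<close>
    also have "\<dots> \<le> gen_gcd s (int (r ^ s)) (int (r ^ s))"
      using r by (intro gen_gcd_ge) auto
    finally have "real (klee_Phi s (r ^ s)) * 1 * 1 \<le> G r r"
      unfolding G_def using tau_s_ge_1[OF s r] by (intro mult_mono) auto
    then show "norm (fh r * gh r * of_nat (klee_Phi s (r ^ s))) \<le> w (r, r)"
      by (simp add: w_def norm_mult mult_left_mono)
  qed auto

  have v: "infsum v (I \<times> I) = C"
  proof -
    have "infsum v (I \<times> I) = infsum v ((\<lambda>r. (r, r)) ` I)"
      by (rule infsum_cong_neutral) (auto simp: v_def)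
    then show ?thesis
      by (simp add: infsum_reindex[OF diag] o_def v_def C_def)
  qed

  \<comment> \<open>For each \<open>n\<close> the product of the expansions is a sum over pairs; the
    finite sum over \<open>n\<close> is then moved inside.\<close>
  have mean: "(\<Sum>n=1..N. f n * g n) / of_nat N = infsum (u N) (I \<times> I)" for N
  proof -
    have "((\<lambda>(r, k). (fh r * c r n) * (gh k * c k n)) has_sum f n * g n) (I \<times> I)" if "n \<in> {1..N}" for n
    proof -
      have "(\<lambda>r. norm (fh r * c r n)) summable_on I" "f n = (\<Sum>\<^sub>\<infinity>r\<in>I. fh r * c r n)"
          "(\<lambda>r. norm (gh r * c r n)) summable_on I" "g n = (\<Sum>\<^sub>\<infinity>r\<in>I. gh r * c r n)"
        using assms(2,3) that by (auto simp: abs_cohen_ramanujan_expansion_def c_def I_def)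
      then show ?thesis
        using has_sum_product_abs[of "\<lambda>r. fh r * c r n" I "\<lambda>r. gh r * c r n" I] by simp
    qed
    then have "((\<lambda>x. \<Sum>n=1..N. (\<lambda>(r, k). (fh r * c r n) * (gh k * c k n)) x)
        has_sum (\<Sum>n=1..N. f n * g n)) (I \<times> I)"
      by (rule has_sum_finite_sum)
    then have "((\<lambda>x. (\<Sum>n=1..N. (\<lambda>(r, k). (fh r * c r n) * (gh k * c k n)) x) * (1 / of_nat N))
        has_sum (\<Sum>n=1..N. f n * g n) * (1 / of_nat N)) (I \<times> I)"
      by (rule has_sum_cmult_left)
    also have "(\<lambda>x. (\<Sum>n=1..N. (\<lambda>(r, k). (fh r * c r n) * (gh k * c k n)) x) * (1 / of_nat N)) = u N"
      by (auto simp: u_def fun_eq_iff sum_distrib_left sum_distrib_right sum_divide_distrib mult_ac)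
    finally show ?thesis
      by (simp add: infsumI)
  qed

  have lim: "(\<lambda>N. infsum (u N) (I \<times> I)) \<longlonglongrightarrow> infsum v (I \<times> I)"
  proof (rule infsum_dominated_convergence[OF w])
    fix x assume "x \<in> I \<times> I"
    then obtain r k where x: "x = (r, k)" "r \<ge> 1" "k \<ge> 1"
      by (auto simp: I_def)
    have "(\<lambda>N. u N (r, k)) \<longlonglongrightarrow> fh r * gh k * (if r = k then of_nat (klee_Phi s (r ^ s)) else 0)"
      unfolding u_def c_def prod.case
      by (intro tendsto_mult_left mean_cohen_ramanujan_sum_mult_tendsto s x)
    then show "(\<lambda>N. u N x) \<longlonglongrightarrow> v x"
      by (auto simp: v_def x split: if_splits)
    fix N
    have "norm (\<Sum>n=1..N. c r n * c k n) \<le> real N * G r k"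
      unfolding c_def G_def by (intro norm_sum_cohen_ramanujan_sum_mult_le s x)
    then have "norm ((\<Sum>n=1..N. c r n * c k n) / of_nat N) \<le> G r k"
      \<comment> \<open>At \<open>N = 0\<close> the quotient is 0 and the bound reduces to
        nonnegativity of \<open>G r k\<close>.\<close>
      by (cases "N = 0") (auto simp: norm_divide field_simps G_def)
    then show "norm (u N x) \<le> w x"
      unfolding u_def w_def x prod.case norm_mult[of "fh r * gh k"] by (intro mult_left_mono) auto
  qed
  then have lim: "(\<lambda>N. (\<Sum>n=1..N. f n * g n) / of_nat N) \<longlonglongrightarrow> C"
    unfolding mean v .
  moreover have "(\<lambda>N. \<Sum>n=1..N. f n * g n) \<sim>[at_top] (\<lambda>N. of_nat N * C)" if "C \<noteq> 0"
    using asymp_equivI'_const[OF lim that] by (simp add: mult.commute)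
  ultimately show ?thesis
    using abs by (simp add: Let_def C_def I_def)
qed

end
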